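(* Let $m,n\ge 2$ be integers and $\mathcal{A}\in\mathbb{R}^{[m,n]}$. The following two statements are equivalent: (a) The tensor $\mathcal{A}$ is R$_0$; (b) The solution map $\mathrm{Sol}:\mathbb{R}^{[m,n]}\times\mathbb{R}^n\rightrightarrows\mathbb{R}^n$ is locally bounded at $(\mathcal{A},a)$, for every $a\in\mathbb{R}^n$.
   Context: $\mathbb{R}^{[m,n]}$ is the real vector space (of dimension $n^m$) of real $m$-th order $n$-dimensional tensors $\mathcal{A}=(a_{i_1\cdots i_m})$, $i_j\in[n]=\{1,\dots,n\}$, with the Frobenius norm $\|\mathcal{A}\|=\sqrt{\sum a_{i_1\cdots i_m}^2}$; $\mathbb{R}^{[m,n]}\times\mathbb{R}^n$ carries the norm $\|(\mathcal{A},a)\|=\sqrt{\|\mathcal{A}\|^2+\sum_i a_i^2}$. For $x\in\mathbb{R}^n$, $\mathcal{A}x^{m-1}\in\mathbb{R}^n$ has components $(\mathcal{A}x^{m-1})_i=\sum_{i_2,\dots,i_m=1}^n a_{ii_2\cdots i_m}x_{i_2}\cdots x_{i_m}$, and $\mathcal{A}x^m=\langle x,\mathcal{A}x^{m-1}\rangle$. For $a\in\mathbb{R}^n$, $\mathrm{Sol}(\mathcal{A},a)$ is the solution set of the tensor complementarity problem $\mathrm{TCP}(\mathcal{A},a)$, i.e. the set of $x\in\mathbb{R}^n$ with $x\ge 0$, $\mathcal{A}x^{m-1}+a\ge 0$, $\mathcal{A}x^m+\langle x,a\rangle=0$ (inequalities componentwise). The solution map is the set-valued map $(\mathcal{A},a)\mapsto\mathrm{Sol}(\mathcal{A},a)$.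 $\mathcal{A}$ is an R$_0$-tensor (is R$_0$) if $\mathrm{Sol}(\mathcal{A},0)=\{0\}$. A set-valued map $\Psi$ is locally bounded at $\bar x$ if there is an open neighborhood $U$ of $\bar x$ such that $\bigcup_{x\in U}\Psi(x)$ is bounded. *)

theory Defs
  imports "HOL-Analysis.Analysis"
begin

text \<open>
  The index type \<open>'m\<close> is the ordered set of the \<open>m\<close> index positions and \<open>'n\<close> the range of each
  index, so \<open>m = CARD('m)\<close>, \<open>n = CARD('n)\<close>, and \<open>j :: 'n ^ 'm\<close> is a multi-index
  \<open>(i\<^sub>1, \<dots>, i\<^sub>m)\<close>.  The library norm on \<open>real ^ ('n ^ 'm)\<close> is the Euclidean norm of the
  entries, i.e. the Frobenius norm, and the library norm on products is
  \<open>norm (A, a) = sqrt ((norm A)\<^sup>2 + (norm a)\<^sup>2)\<close>.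
\<close>

type_synonym ('m, 'n) tensor = "real ^ ('n ^ 'm)"

definition first_pos :: "'m::{finite,linorder}" where
  "first_pos = Min UNIV"

definition tensor_apply ::
    "('m::{finite,linorder}, 'n::finite) tensor \<Rightarrow> real ^ 'n \<Rightarrow> real ^ 'n" where
  "tensor_apply A x =
     (\<chi> i. \<Sum>j\<in>{j. j $ first_pos = i}. A $ j * (\<Prod>k\<in>UNIV - {first_pos}. x $ (j $ k)))"

definition tensor_form ::
    "('m::{finite,linorder}, 'n::finite) tensor \<Rightarrow> real ^ 'n \<Rightarrow> real" where
  "tensor_form A x = x \<bullet> tensor_apply A x"

definition Sol ::
    "('m::{finite,linorder}, 'n::finite) tensor \<Rightarrow> real ^ 'n \<Rightarrow> (real ^ 'n) set" where
  "Sol A a = {x. (\<forall>i. 0 \<le> x $ i) \<and> (\<forall>i. 0 \<le> (tensor_apply A x + a) $ i) \<and>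
                 tensor_form A x + x \<bullet> a = 0}"

definition R0_tensor :: "('m::{finite,linorder}, 'n::finite) tensor \<Rightarrow> bool" where
  "R0_tensor A \<longleftrightarrow> Sol A 0 = {0}"

definition locally_bounded_at ::
    "('a::topological_space \<Rightarrow> 'b::metric_space set) \<Rightarrow> 'a \<Rightarrow> bool" where
  "locally_bounded_at \<Psi> x \<longleftrightarrow> (\<exists>U. open U \<and> x \<in> U \<and> bounded (\<Union>y\<in>U. \<Psi> y))"

end

theory Submission
  imports Defs
begin

text \<open>
  Solutions scale: \<open>t Sol(A, a) \<subseteq> Sol(A, t\<^sup>m\<^sup>-\<^sup>1 a)\<close> for \<open>t \<ge> 0\<close>.  Hence \<open>Sol(A, 0)\<close> is a cone, which is
  bounded only if it is \<open>{0}\<close>.  Conversely, if solutions \<open>x\<^sub>k\<close> for data \<open>(B\<^sub>k, b\<^sub>k)\<close> converging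
  to \<open>(A, a)\<close> are unbounded, then \<open>x\<^sub>k\<close> divided by its norm solves the problem with data
  \<open>B\<^sub>k\<close> and a vector tending to \<open>0\<close>; since the graph of the solution map is closed, a limit point
  is a unit vector in \<open>Sol(A, 0)\<close>.
\<close>

text \<open>Each monomial carries one factor of \<open>x\<close> for every index position other than
  \<open>first_pos\<close>, hence the degree \<open>CARD('m) - 1\<close>.\<close>

lemma tensor_apply_scaleR:
  fixes A :: "('m::{finite,linorder}, 'n::finite) tensor"
  shows "tensor_apply A (t *\<^sub>R x) = t ^ (CARD('m) - 1) *\<^sub>R tensor_apply A x"
  by (simp add: vec_eq_iff tensor_apply_def prod.distrib sum_distrib_left card_Diff_singleton
      mult.left_commute)

lemma Sol_scaleR:
  fixes A :: "('m::{finite,linorder}, 'n::finite) tensor"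
  assumes "x \<in> Sol A a" "0 \<le> t"
  shows "t *\<^sub>R x \<in> Sol A (t ^ (CARD('m) - 1) *\<^sub>R a)"
proof -
  let ?s = "t ^ (CARD('m) - 1)"
  have x: "\<And>i. 0 \<le> x $ i" "\<And>i. 0 \<le> (tensor_apply A x + a) $ i"
    and orth: "x \<bullet> tensor_apply A x + x \<bullet> a = 0"
    using assms(1) by (auto simp: Sol_def tensor_form_def)
  have "tensor_apply A (t *\<^sub>R x) + ?s *\<^sub>R a = ?s *\<^sub>R (tensor_apply A x + a)"
    by (simp add: tensor_apply_scaleR scaleR_right_distrib)
  then have "0 \<le> (tensor_apply A (t *\<^sub>R x) + ?s *\<^sub>R a) $ i" for i
    using x(2)[of i] assms(2) by simp
  moreover have "tensor_form A (t *\<^sub>R x) + (t *\<^sub>R x) \<bullet> (?s *\<^sub>R a)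
      = t * ?s * (x \<bullet> tensor_apply A x + x \<bullet> a)"
    by (simp add: tensor_form_def tensor_apply_scaleR algebra_simps)
  ultimately show ?thesis
    using x(1) assms(2) orth by (simp add: Sol_def)
qed

text \<open>With at least two index positions the degree \<open>CARD('m) - 1\<close> is positive, so
  homogeneity with factor \<open>0\<close> makes \<open>tensor_apply A 0\<close> vanish.\<close>

lemma zero_in_Sol_zero:
  fixes A :: "('m::{finite,linorder}, 'n::finite) tensor"
  assumes "CARD('m) \<ge> 2"
  shows "0 \<in> Sol A 0"
  using tensor_apply_scaleR[of A 0 0] assms by (simp add: Sol_def tensor_form_def power_0_left)

lemma tendsto_tensor_apply:
  assumes "(B \<longlongrightarrow> A) F" "(y \<longlongrightarrow> x) F"
  shows "((\<lambda>k. tensor_apply (B k) (y k)) \<longlongrightarrow> tensor_apply A x) F"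
  unfolding tensor_apply_def
  by (intro vec_tendstoI) (auto intro!: tendsto_intros assms)

text \<open>The conditions defining \<open>Sol\<close> are weak inequalities and one equation
  between jointly continuous functions of tensor, vector and point, so they survive limits.\<close>

lemma Sol_closed_graph:
  assumes "B \<longlonglongrightarrow> A" "b \<longlonglongrightarrow> a" "y \<longlonglongrightarrow> x" and sol: "\<And>k. y k \<in> Sol (B k) (b k)"
  shows "x \<in> Sol A a"
proof -
  note lim = tendsto_tensor_apply[OF assms(1,3)] assms(2,3)
  have "0 \<le> x $ i" for i
    by (rule LIMSEQ_le_const[OF tendsto_vec_nth[OF assms(3)]]) (use sol in \<open>auto simp: Sol_def\<close>)
  moreover have "0 \<le> (tensor_apply A x + a) $ i" for i
    by (rule LIMSEQ_le_const[OF tendsto_vec_nth[OF tendsto_add[OF lim(1,2)]]])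
      (use sol in \<open>auto simp: Sol_def\<close>)
  moreover have "(\<lambda>k. y k \<bullet> tensor_apply (B k) (y k) + y k \<bullet> b k) \<longlonglongrightarrow> x \<bullet> tensor_apply A x + x \<bullet> a"
    by (intro tendsto_intros lim)
  then have "x \<bullet> tensor_apply A x + x \<bullet> a = 0"
    using sol by (simp add: Sol_def tensor_form_def LIMSEQ_const_iff)
  ultimately show ?thesis
    by (simp add: Sol_def tensor_form_def)
qed

lemma R0_tensor_if_bounded:
  fixes A :: "('m::{finite,linorder}, 'n::finite) tensor"
  assumes "CARD('m) \<ge> 2" "bounded (Sol A 0)"
  shows "R0_tensor A"
proof -
  obtain c where c: "\<And>x. x \<in> Sol A 0 \<Longrightarrow> norm x \<le> c"
    using assms(2) by (auto simp: bounded_iff)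
  have "x = 0" if "x \<in> Sol A 0" for x
  proof (rule ccontr)
    assume "x \<noteq> 0"
    \<comment> \<open>The factor stretches \<open>x\<close> to norm
      \<open>\<bar>c\<bar> + 1\<close>, beyond the bound \<open>c\<close>; the absolute value makes
      it nonnegative whatever the sign of \<open>c\<close>.\<close>
    have "norm (((\<bar>c\<bar> + 1) / norm x) *\<^sub>R x) \<le> c"
      using Sol_scaleR[OF that, of "(\<bar>c\<bar> + 1) / norm x"] by (intro c) simp
    with \<open>x \<noteq> 0\<close> show False by simp
  qed
  with zero_in_Sol_zero[OF assms(1), of A] show ?thesis
    by (auto simp: R0_tensor_def)
qed

lemma locally_bounded_at_Sol:
  fixes A :: "('m::{finite,linorder}, 'n::finite) tensor"
  assumes m: "CARD('m) \<ge> 2" and "R0_tensor A"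
  shows "locally_bounded_at (\<lambda>(B, b). Sol B b) (A, a)"
proof (rule ccontr)
  assume not: "\<not> ?thesis"
  have "\<exists>B b x. dist (A, a) (B, b) < inverse (real (Suc k)) \<and> x \<in> Sol B b \<and> real (Suc k) < norm x"
    for k
  proof -
    \<comment> \<open>Each ball is an open neighborhood of \<open>(A, a)\<close>, so the solutions
      over it must be unbounded.\<close>
    have "\<not> bounded (\<Union>p \<in> ball (A, a) (inverse (real (Suc k))). case p of (B, b) \<Rightarrow> Sol B b)"
      using not unfolding locally_bounded_at_def
      by (metis open_ball centre_in_ball inverse_positive_iff_positive of_nat_0_less_iff zero_less_Suc)
    then show ?thesis
      by (force simp: bounded_iff not_le)
  qed
  then obtain B b x where close: "\<And>k. dist (A, a) (B k, b k) < inverse (real (Suc k))"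
    and sol: "\<And>k. x k \<in> Sol (B k) (b k)" and large: "\<And>k. real (Suc k) < norm (x k)"
    by metis
  have "(\<lambda>k. dist (B k, b k) (A, a)) \<longlonglongrightarrow> 0"
    by (rule tendsto_sandwich[OF _ _ tendsto_const LIMSEQ_inverse_real_of_nat])
      (use close in \<open>auto simp: dist_commute intro!: always_eventually less_imp_le\<close>)
  then have lim: "(\<lambda>k. (B k, b k)) \<longlonglongrightarrow> (A, a)"
    by (simp only: tendsto_dist_iff[symmetric])
  have B: "B \<longlonglongrightarrow> A" and b: "b \<longlonglongrightarrow> a"
    using tendsto_fst[OF lim] tendsto_snd[OF lim] by simp_all
  define t where "t k = inverse (norm (x k))" for k
  have pos: "0 < norm (x k)" for k
    using large[of k] by linarith
  have "t k \<le> inverse (real (Suc k))" for k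
    unfolding t_def using large[of k] by (intro le_imp_inverse_le) auto
  then have "t \<longlonglongrightarrow> 0"
    by (intro tendsto_sandwich[OF _ _ tendsto_const LIMSEQ_inverse_real_of_nat])
      (auto simp: t_def)
  then have "(\<lambda>k. t k ^ (CARD('m) - 1) *\<^sub>R b k) \<longlonglongrightarrow> 0 ^ (CARD('m) - 1) *\<^sub>R a"
    by (intro tendsto_intros b)
  \<comment> \<open>The exponent is at least 1, so the power of \<open>0\<close> is \<open>0\<close>
    and the limit no longer depends on \<open>a\<close>.\<close>
  then have c: "(\<lambda>k. t k ^ (CARD('m) - 1) *\<^sub>R b k) \<longlonglongrightarrow> 0"
    using m by (simp add: power_0_left)
  define y where "y k = t k *\<^sub>R x k" for k
  have y: "norm (y k) = 1" for k
    using pos[of k] by (simp add: y_def t_def)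
  \<comment> \<open>Compactness of the unit sphere yields a limit point of norm 1, hence a nonzero
    one.\<close>
  then have "\<forall>k. y k \<in> sphere 0 1" by simp
  then obtain l r where "l \<in> sphere 0 1" and r: "strict_mono r" and l: "(y \<circ> r) \<longlonglongrightarrow> l"
    using compact_sphere[of "0 :: real ^ 'n" 1] unfolding compact_def by metis
  have "l \<in> Sol A 0"
  proof (rule Sol_closed_graph)
    show "(B \<circ> r) \<longlonglongrightarrow> A" "((\<lambda>k. t k ^ (CARD('m) - 1) *\<^sub>R b k) \<circ> r) \<longlonglongrightarrow> 0"
      by (rule LIMSEQ_subseq_LIMSEQ[OF _ r], fact)+
    show "(y \<circ> r) k \<in> Sol ((B \<circ> r) k) (((\<lambda>k. t k ^ (CARD('m) - 1) *\<^sub>R b k) \<circ> r) k)" for k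
      using Sol_scaleR[OF sol, of "t (r k)"] by (simp add: y_def t_def)
  qed (fact l)
  with \<open>l \<in> sphere 0 1\<close> assms(2) show False
    by (simp add: R0_tensor_def)
qed

theorem corollary3p1:
  fixes A :: "('m::{finite,linorder}, 'n::finite) tensor"
  assumes "CARD('m) \<ge> 2" and "CARD('n) \<ge> 2"
  shows "R0_tensor A \<longleftrightarrow>
    (\<forall>a :: real ^ 'n.
       locally_bounded_at (\<lambda>(B :: ('m, 'n) tensor, b :: real ^ 'n). Sol B b) (A, a))"
proof
  assume "\<forall>a :: real ^ 'n.
       locally_bounded_at (\<lambda>(B :: ('m, 'n) tensor, b :: real ^ 'n). Sol B b) (A, a)"
  \<comment> \<open>The instance \<open>a = 0\<close> is taken: \<open>(A, 0) \<in> U\<close> makes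
    \<open>Sol A 0\<close> part of a bounded union.\<close>
  then obtain U where "(A, 0) \<in> U" and
    "bounded (\<Union>p \<in> U. case p of (B :: ('m, 'n) tensor, b :: real ^ 'n) \<Rightarrow> Sol B b)"
    unfolding locally_bounded_at_def by blast
  then have "bounded (Sol A 0)"
    by (force elim: bounded_subset)
  with assms(1) show "R0_tensor A"
    by (rule R0_tensor_if_bounded)
qed (use locally_bounded_at_Sol[OF assms(1)] in blast)

end
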